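(* Let $p\ge 1$, $0<\alpha<2$, let $(X,Y)$ be a pair of $\mathbb{R}^p$-valued random vectors, and let $(X_1,Y_1),\dots,(X_4,Y_4)$ be independent, identically distributed copies of $(X,Y)$. If $E(|X|^{\alpha}+|Y|^{\alpha})<\infty$, then $$\mathrm{siCor}^{(\alpha)}(X,Y)=\frac{2\mathcal{J}_1(X,Y)-\mathcal{J}_2(X,Y)-\mathcal{J}_3(X,Y)}{\mathcal{K}_1(X,Y)+\mathcal{K}_2(X,Y)-\mathcal{K}_3(X,Y)}$$ (with the right-hand side read as $0$ when its denominator is $0$), where $$\mathcal{J}_1(X,Y)=E|X_1+Y_1-X_2-Y_3|^{\alpha},\quad \mathcal{J}_2(X,Y)=E|X_1+Y_2-X_3-Y_4|^{\alpha},\quad \mathcal{J}_3(X,Y)=E|X_1+Y_1-X_2-Y_2|^{\alpha},$$ $$\mathcal{K}_1(X,Y)=E|X_1-X_2|^{\alpha},\quad \mathcal{K}_2(X,Y)=E|Y_3-Y_4|^{\alpha},\quad \mathcal{K}_3(X,Y)=E|X_1-X_2+Y_3-Y_4|^{\alpha}.$$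
   Context: $|\cdot|$ denotes the Euclidean norm on $\mathbb{R}^p$ (and the modulus for complex numbers), and $\langle\cdot,\cdot\rangle$ the Euclidean scalar product. For random vectors $X,Y\in\mathbb{R}^p$ let $\phi_{X,Y}(s,t)=E\,e^{i\langle s,X\rangle+i\langle t,Y\rangle}$, $\phi_X(t)=E\,e^{i\langle t,X\rangle}$, $\phi_Y(t)=E\,e^{i\langle t,Y\rangle}$. For $0<\alpha<2$ put $\rho_\alpha(t)=c(p,\alpha)^{-1}|t|^{-\alpha-p}$ with $c(p,\alpha)=\dfrac{2\pi^{p/2}\Gamma(1-\alpha/2)}{\alpha\,2^{\alpha}\,\Gamma((\alpha+p)/2)}$. The $\alpha$-sub-independent covariance is $$\mathrm{siCov}^{(\alpha)}(X,Y)=\int_{\mathbb{R}^p}\bigl|\phi_{X,Y}(t,t)-\phi_X(t)\phi_Y(t)\bigr|^2\rho_\alpha(t)\,dt,$$ and the $\alpha$-sub-independent correlation is $$\mathrm{siCor}^{(\alpha)}(X,Y)=\frac{\mathrm{siCov}^{(\alpha)}(X,Y)}{\int_{\mathbb{R}^p}(1-|\phi_X(t)|^2)(1-|\phi_Y(t)|^2)\rho_\alpha(t)\,dt}$$ if the denominator is positive, and $\mathrm{siCor}^{(\alpha)}(X,Y)=0$ otherwise. *)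

theory Defs
  imports "HOL-Probability.Probability"
begin

text \<open>
  \<open>\<real>\<^sup>p\<close> is an arbitrary Euclidean space \<open>'a\<close> with \<open>p = DIM('a)\<close>; the library's
  \<^const>\<open>char\<close> only covers measures on \<^typ>\<open>real\<close>.
\<close>

definition char_vec :: "'w measure \<Rightarrow> ('w \<Rightarrow> 'a::euclidean_space) \<Rightarrow> 'a \<Rightarrow> complex" where
  "char_vec M X t = (CLINT w|M. iexp (t \<bullet> X w))"

definition joint_char ::
  "'w measure \<Rightarrow> ('w \<Rightarrow> 'a::euclidean_space) \<Rightarrow> ('w \<Rightarrow> 'a) \<Rightarrow> 'a \<Rightarrow> 'a \<Rightarrow> complex" where
  "joint_char M X Y s t = (CLINT w|M. iexp (s \<bullet> X w + t \<bullet> Y w))"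

definition c_const :: "nat \<Rightarrow> real \<Rightarrow> real" where
  "c_const p \<alpha> =
     2 * pi powr (real p / 2) * Gamma (1 - \<alpha> / 2) / (\<alpha> * 2 powr \<alpha> * Gamma ((\<alpha> + real p) / 2))"

text \<open>At \<open>t = 0\<close>, a null set, the value is \<open>0\<close> because \<open>0 powr a = 0\<close>.\<close>

definition rho :: "real \<Rightarrow> 'a::euclidean_space \<Rightarrow> real" where
  "rho \<alpha> t = inverse (c_const DIM('a) \<alpha>) * norm t powr (- \<alpha> - real DIM('a))"

text \<open>
  The integrals below are Bochner integrals, with value \<open>0\<close> in case of divergence. Both are
  finite whenever \<open>X\<close> and \<open>Y\<close> have finite absolute moments of order \<open>\<alpha>\<close>.
\<close>

definition siCov ::
  "'w measure \<Rightarrow> real \<Rightarrow> ('w \<Rightarrow> 'a::euclidean_space) \<Rightarrow> ('w \<Rightarrow> 'a) \<Rightarrow> real" where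
  "siCov M \<alpha> X Y =
     (LINT t|lborel. (cmod (joint_char M X Y t t - char_vec M X t * char_vec M Y t))\<^sup>2 * rho \<alpha> t)"

definition siCor_denom ::
  "'w measure \<Rightarrow> real \<Rightarrow> ('w \<Rightarrow> 'a::euclidean_space) \<Rightarrow> ('w \<Rightarrow> 'a) \<Rightarrow> real" where
  "siCor_denom M \<alpha> X Y =
     (LINT t|lborel. (1 - (cmod (char_vec M X t))\<^sup>2) * (1 - (cmod (char_vec M Y t))\<^sup>2) * rho \<alpha> t)"

definition siCor ::
  "'w measure \<Rightarrow> real \<Rightarrow> ('w \<Rightarrow> 'a::euclidean_space) \<Rightarrow> ('w \<Rightarrow> 'a) \<Rightarrow> real" where
  "siCor M \<alpha> X Y =
     (if siCor_denom M \<alpha> X Y > 0 then siCov M \<alpha> X Y / siCor_denom M \<alpha> X Y else 0)"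

text \<open>
  The pairs \<open>(X\<^sub>i, Y\<^sub>i)\<close>, \<open>i \<in> I\<close>, are independent copies of \<open>(X, Y)\<close>. They live on a
  probability space \<open>N\<close> that may differ from the space \<open>M\<close> carrying \<open>(X, Y)\<close>.
\<close>

definition iid_copies ::
  "'v measure \<Rightarrow> nat set \<Rightarrow> (nat \<Rightarrow> 'v \<Rightarrow> 'a::euclidean_space) \<Rightarrow> (nat \<Rightarrow> 'v \<Rightarrow> 'a) \<Rightarrow>
   'w measure \<Rightarrow> ('w \<Rightarrow> 'a) \<Rightarrow> ('w \<Rightarrow> 'a) \<Rightarrow> bool" where
  "iid_copies N I Xc Yc M X Y \<longleftrightarrow>
     prob_space.indep_vars N (\<lambda>_. borel) (\<lambda>i w. (Xc i w, Yc i w)) I \<and>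
     (\<forall>i\<in>I. distr N borel (\<lambda>w. (Xc i w, Yc i w)) = distr M borel (\<lambda>w. (X w, Y w)))"

end

theory Submission
  imports Defs
begin

text \<open>
  The numerator and the denominator of the correlation are integrals of linear combinations of
  terms \<open>1 - Re E exp(i\<langle>t, A\<rangle>)\<close>, where \<open>A\<close> is one of the six linear combinations of independent
  copies: products of characteristic functions are characteristic functions of independent sums.
  By Tonelli it remains to integrate \<open>1 - cos\<langle>t, x\<rangle>\<close> against \<open>|t|\<close> to the power \<open>-\<alpha> - p\<close>, which
  gives \<open>C |x|\<close> to the power \<open>\<alpha>\<close>. Writing the weight as a mixture of Gaussians in \<open>t\<close> reduces this
  to the Gaussian Fourier transform and a scaling in one dimension. The value of \<open>C\<close> cancels in
  the ratio; only its positivity and finiteness matter.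
\<close>

section \<open>Fourier transforms of Gaussians\<close>

text \<open>A linear substitution reduces this to the characteristic function of the standard normal
  distribution. Integrability is stated separately because the product formula in higher dimension
  needs it for each factor.\<close>

lemma real_gaussian_fourier:
  fixes s a :: real
  assumes "s > 0"
  shows "integrable lborel (\<lambda>u. iexp (a * u) * complex_of_real (exp (- s * u\<^sup>2)))" (is ?I)
    and "(CLINT u|lborel. iexp (a * u) * complex_of_real (exp (- s * u\<^sup>2)))
           = complex_of_real (sqrt (pi / s) * exp (- a\<^sup>2 / (4 * s)))" (is ?E)
proof -
  \<comment> \<open>With this scale \<open>s * \<sigma>\<^sup>2\<close> is 1/2, so u = \<sigma> v
    turns the Gaussian into \<open>sqrt (2 * pi)\<close> times the standard normal density. The
    summand 0 below matches the affine form of the change of variables.\<close>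
  define \<sigma> where "\<sigma> = 1 / sqrt (2 * s)"
  have \<sigma>: "\<sigma> > 0" "\<sigma>\<^sup>2 = 1 / (2 * s)"
    using assms by (auto simp: \<sigma>_def power_divide)
  let ?f = "\<lambda>u. iexp (a * u) * complex_of_real (exp (- s * u\<^sup>2))"
  have scale: "?f (0 + \<sigma> * v) = sqrt (2 * pi) * (std_normal_density v *\<^sub>R iexp ((a * \<sigma>) * v))" for v
  proof -
    have "s * (\<sigma> * v)\<^sup>2 = v\<^sup>2 / 2"
      using assms by (simp add: power_mult_distrib \<sigma>)
    then show ?thesis
      by (simp add: std_normal_density_def scaleR_conv_of_real mult_ac)
  qed
  interpret S: prob_space std_normal_distribution
    by (rule prob_space_normal_density) simp
  have "integrable std_normal_distribution (\<lambda>v. iexp ((a * \<sigma>) * v))"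
    by (intro S.integrable_const_bound[of _ 1]) (auto simp del: of_real_mult)
  then have int: "integrable lborel (\<lambda>v. std_normal_density v *\<^sub>R iexp ((a * \<sigma>) * v))"
    by (subst (asm) integrable_density) auto
  then have "integrable lborel (\<lambda>v. ?f (0 + \<sigma> * v))"
    unfolding scale by (rule integrable_mult_right)
  then show ?I
    using lborel_integrable_real_affine_iff[of \<sigma> ?f 0] \<sigma> by simp
  have "(CLINT u|lborel. ?f u) = \<sigma> *\<^sub>R (CLINT v|lborel. ?f (0 + \<sigma> * v))"
    using lborel_integral_real_affine[of \<sigma> ?f 0] \<sigma>(1) by simp
  also have "(CLINT v|lborel. ?f (0 + \<sigma> * v))
      = sqrt (2 * pi) * (CLINT v|lborel. std_normal_density v *\<^sub>R iexp ((a * \<sigma>) * v))"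
    unfolding scale by (rule integral_mult_right_zero)
  also have "(CLINT v|lborel. std_normal_density v *\<^sub>R iexp ((a * \<sigma>) * v))
      = char std_normal_distribution (a * \<sigma>)"
    unfolding char_def by (subst integral_density) auto
  also have "\<dots> = complex_of_real (exp (- (a\<^sup>2 / (4 * s))))"
    unfolding char_std_normal_distribution by (simp add: power_mult_distrib \<sigma> field_simps)
  finally show ?E
    using assms by (simp add: \<sigma>_def scaleR_conv_of_real real_sqrt_mult real_sqrt_divide
        flip: of_real_mult of_real_divide)
qed

text \<open>Both the character and the Gaussian factor over the coordinates in \<open>Basis\<close>,
  and \<open>lborel\<close> is the image of the product of one-dimensional Lebesgue measures. The
  integral is therefore a product of one-dimensional ones.\<close>

lemma gaussian_fourier:
  fixes x :: "'a::euclidean_space"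
  assumes s: "s > 0"
  shows "integrable lborel (\<lambda>t. iexp (t \<bullet> x) * complex_of_real (exp (- s * (norm t)\<^sup>2)))" (is ?I)
    and "(CLINT t|lborel. iexp (t \<bullet> x) * complex_of_real (exp (- s * (norm t)\<^sup>2)))
           = complex_of_real ((pi / s) powr (DIM('a) / 2) * exp (- (norm x)\<^sup>2 / (4 * s)))" (is ?E)
proof -
  interpret P: product_sigma_finite "\<lambda>_::'a. lborel :: real measure" ..
  let ?P = "\<Pi>\<^sub>M b\<in>(Basis::'a set). (lborel :: real measure)"
  let ?F = "\<lambda>t::'a. iexp (t \<bullet> x) * complex_of_real (exp (- s * (norm t)\<^sup>2))"
  let ?g = "\<lambda>(b::'a) u. iexp ((x \<bullet> b) * u) * complex_of_real (exp (- s * u\<^sup>2))"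
  let ?T = "\<lambda>f. \<Sum>b\<in>(Basis::'a set). f b *\<^sub>R b"
  have T: "?T \<in> ?P \<rightarrow>\<^sub>M borel"
    by measurable
  have F: "?F \<in> borel_measurable borel"
    by measurable
  have split: "?F (?T f) = (\<Prod>b\<in>Basis. ?g b (f b))" for f
  proof -
    have 1: "?T f \<bullet> x = (\<Sum>b\<in>Basis. (x \<bullet> b) * f b)"
      by (simp add: inner_sum_left inner_commute[of x] mult.commute)
    have "(norm (?T f))\<^sup>2 = (\<Sum>b\<in>Basis. (f b)\<^sup>2)"
      by (subst power2_norm_eq_inner, subst euclidean_inner) (simp add: power2_eq_square)
    then have "exp (- s * (norm (?T f))\<^sup>2) = (\<Prod>b\<in>Basis. exp (- s * (f b)\<^sup>2))"
      by (simp add: exp_sum sum_distrib_left flip: sum_negf)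
    moreover have "iexp (?T f \<bullet> x) = (\<Prod>b\<in>Basis. iexp ((x \<bullet> b) * f b))"
      unfolding 1 of_real_sum sum_distrib_left by (simp add: exp_sum)
    ultimately show ?thesis
      by (simp only: prod.distrib of_real_prod)
  qed
  have "integrable ?P (\<lambda>f. ?F (?T f))"
    unfolding split by (intro P.product_integrable_prod real_gaussian_fourier s) auto
  then show ?I
    unfolding lborel_eq[where 'a='a] by (subst integrable_distr_eq[OF T F])
  have "(CLINT t|lborel. ?F t) = (CLINT f|?P. ?F (?T f))"
    unfolding lborel_eq[where 'a='a] by (rule integral_distr[OF T F])
  also have "\<dots> = (\<Prod>b\<in>Basis. CLINT u|lborel. ?g b u)"
    unfolding split by (intro P.product_integral_prod real_gaussian_fourier s) auto
  also have "\<dots> = complex_of_real (\<Prod>b\<in>Basis. sqrt (pi / s) * exp (- (x \<bullet> b)\<^sup>2 / (4 * s)))"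
    by (simp only: real_gaussian_fourier[OF s] of_real_prod)
  also have "(\<Prod>b\<in>Basis. sqrt (pi / s) * exp (- (x \<bullet> b)\<^sup>2 / (4 * s)))
      = sqrt (pi / s) ^ DIM('a) * exp (\<Sum>b\<in>Basis. - (x \<bullet> b)\<^sup>2 / (4 * s))"
    by (simp add: prod.distrib exp_sum)
  also have "(\<Sum>b\<in>Basis. - (x \<bullet> b)\<^sup>2 / (4 * s)) = - (norm x)\<^sup>2 / (4 * s)"
    by (subst power2_norm_eq_inner, subst euclidean_inner)
      (simp add: power2_eq_square sum_negf flip: sum_divide_distrib)
  also have "sqrt (pi / s) ^ DIM('a) = (pi / s) powr (DIM('a) / 2)"
    using s by (simp add: powr_half_sqrt[symmetric] powr_powr flip: powr_realpow)
  finally show ?E .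
qed

text \<open>The integrand is the real part of the difference of the Fourier integrands at 0 and at
  \<open>x\<close>. Since it is nonnegative, the Bochner integral is also the extended nonnegative
  one, the form that Tonelli requires.\<close>

lemma gaussian_one_minus_cos:
  fixes x :: "'a::euclidean_space"
  assumes s: "s > 0"
  shows "(\<integral>\<^sup>+t. ennreal ((1 - cos (t \<bullet> x)) * exp (- s * (norm t)\<^sup>2)) \<partial>lborel)
         = ennreal ((pi / s) powr (DIM('a) / 2) * (1 - exp (- (norm x)\<^sup>2 / (4 * s))))"
proof -
  let ?F = "\<lambda>x t::'a. iexp (t \<bullet> x) * complex_of_real (exp (- s * (norm t)\<^sup>2))"
  have eq: "(1 - cos (t \<bullet> x)) * exp (- s * (norm t)\<^sup>2) = Re (?F 0 t - ?F x t)" for t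
    by (simp only: minus_complex.simps times_complex.simps Re_complex_of_real Im_complex_of_real Re_exp Im_exp) (simp add: algebra_simps)
  have int: "integrable lborel (\<lambda>t. ?F 0 t - ?F x t)"
    by (intro Bochner_Integration.integrable_diff gaussian_fourier s)
  have nonneg: "0 \<le> Re (?F 0 t - ?F x t)" for t
    unfolding eq[symmetric] by simp
  have "(LINT t|lborel. Re (?F 0 t - ?F x t)) = Re (CLINT t|lborel. ?F 0 t - ?F x t)"
    by (rule integral_Re[OF int])
  also have "\<dots> = (pi / s) powr (DIM('a) / 2) * (1 - exp (- (norm x)\<^sup>2 / (4 * s)))"
    by (subst Bochner_Integration.integral_diff, intro gaussian_fourier s, intro gaussian_fourier s,
        simp only: gaussian_fourier[OF s]) (simp add: algebra_simps)
  finally show ?thesis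
    unfolding eq using nonneg by (subst nn_integral_eq_integral[OF integrable_Re[OF int]]) simp_all
qed

section \<open>Powers of the norm as Gaussian mixtures\<close>

text \<open>This is the Gamma integral at b/2 after replacing s by |t|^2 s.\<close>

lemma norm_powr_subordination:
  fixes t :: "'a::real_normed_vector"
  assumes "b > 0" "t \<noteq> 0"
  shows "(\<integral>\<^sup>+s. ennreal (indicator {0<..} s * s powr (b / 2 - 1) * exp (- s * (norm t)\<^sup>2)) \<partial>lborel)
         = ennreal (Gamma (b / 2) * norm t powr (- b))"
proof -
  let ?c = "(norm t)\<^sup>2"
  have c: "?c > 0" using assms by simp
  have pw: "?c powr z = norm t powr (2 * z)" for z
    using assms by (simp add: powr_powr flip: powr_numeral)
  have pw': "?c powr (b / 2 - 1) = norm t powr (b - 2)"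
    using pw[of "b / 2 - 1"] by (simp only: right_diff_distrib) simp
  have "ennreal (Gamma (b / 2))
      = (\<integral>\<^sup>+s. ennreal (indicator {0..} s * s powr (b / 2 - 1) / exp s) \<partial>lborel)"
    using assms by (subst Gamma_conv_nn_integral_real) auto
  also have "\<dots> = ennreal \<bar>?c\<bar> * (\<integral>\<^sup>+s. ennreal (indicator {0..} (0 + ?c * s) * (0 + ?c * s) powr (b / 2 - 1)
      / exp (0 + ?c * s)) \<partial>lborel)"
    using c by (intro nn_integral_real_affine) auto
  also have "\<dots> = ennreal ?c * (\<integral>\<^sup>+s. ennreal (norm t powr (b - 2)) *
      ennreal (indicator {0<..} s * s powr (b / 2 - 1) * exp (- s * ?c)) \<partial>lborel)"
  proof (intro arg_cong2[where f="(*)"] nn_integral_cong)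
    fix s :: real
    have "indicator {0..} (0 + ?c * s) * (0 + ?c * s) powr (b / 2 - 1) / exp (0 + ?c * s)
        = norm t powr (b - 2) * (indicator {0<..} s * s powr (b / 2 - 1) * exp (- s * ?c))"
    \<comment> \<open>At s = 0 the indicators of the closed and the open half-line differ, but both
      sides vanish because \<open>0 powr z = 0\<close>.\<close>
    proof (cases s "0 :: real" rule: linorder_cases)
      case greater
      have "(?c * s) powr (b / 2 - 1) = norm t powr (b - 2) * s powr (b / 2 - 1)"
        by (simp only: powr_mult pw')
      moreover have "exp (- s * ?c) = inverse (exp (?c * s))"
        by (simp add: exp_minus mult.commute)
      moreover have "indicator {0..} (0 + ?c * s) = (1 :: real)" "indicator {0<..} s = (1 :: real)"
        using greater by simp_all
      ultimately show ?thesis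
        by (simp only: add_0 mult_1 mult.assoc divide_inverse)
    next
      case less
      then have "?c * s < 0"
        using c by (simp add: mult_pos_neg)
      with less show ?thesis by (simp add: indicator_def)
    qed simp
    then show "ennreal (indicator {0..} (0 + ?c * s) * (0 + ?c * s) powr (b / 2 - 1) / exp (0 + ?c * s))
        = ennreal (norm t powr (b - 2)) * ennreal (indicator {0<..} s * s powr (b / 2 - 1) * exp (- s * ?c))"
      by (simp only: ennreal_mult' powr_ge_zero)
  qed simp
  also have "\<dots> = ennreal (norm t powr b) *
      (\<integral>\<^sup>+s. ennreal (indicator {0<..} s * s powr (b / 2 - 1) * exp (- s * ?c)) \<partial>lborel)"
  proof -
    have "?c * norm t powr (b - 2) = norm t powr b"
      using assms by (simp add: powr_diff)
    then show ?thesis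
      by (subst nn_integral_cmult) (auto simp flip: mult.assoc ennreal_mult')
  qed
  \<comment> \<open>Multiplying by the inverse power isolates the integral without dividing in
    \<open>ennreal\<close>.\<close>
  finally have "ennreal (norm t powr (-b)) * ennreal (Gamma (b / 2)) =
      ennreal (norm t powr (-b) * norm t powr b) *
      (\<integral>\<^sup>+s. ennreal (indicator {0<..} s * s powr (b / 2 - 1) * exp (- s * ?c)) \<partial>lborel)"
    by (simp add: mult.assoc ennreal_mult')
  moreover have "norm t powr (-b) * norm t powr b = 1"
    using assms by (simp flip: powr_add)
  ultimately show ?thesis
    using assms by (simp add: mult.commute flip: ennreal_mult')
qed

text \<open>What is left of the mixture over s once the Gaussian integral in t is evaluated, with r
  standing for |x|^2. Values in \<open>ennreal\<close> postpone the question of finiteness.\<close>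

definition gauss_mixture :: "real \<Rightarrow> real \<Rightarrow> ennreal" where
  "gauss_mixture a r = (\<integral>\<^sup>+s. ennreal (indicator {0<..} s * s powr (a / 2 - 1) * (1 - exp (- r / (4 * s)))) \<partial>lborel)"

text \<open>Replacing s by r s frees the exponential of r; the Jacobian r and the power r^(a/2 - 1)
  combine to r^(a/2). This is the source of the homogeneity |x|^\<alpha>.\<close>

lemma gauss_mixture_scale:
  assumes "r > 0"
  shows "gauss_mixture a r = ennreal (r powr (a / 2)) * gauss_mixture a 1"
proof -
  have "gauss_mixture a r = ennreal \<bar>r\<bar> * (\<integral>\<^sup>+s. ennreal (indicator {0<..} (0 + r * s) * (0 + r * s) powr (a / 2 - 1)
      * (1 - exp (- r / (4 * (0 + r * s))))) \<partial>lborel)"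
    unfolding gauss_mixture_def using assms by (intro nn_integral_real_affine) auto
  also have "\<dots> = ennreal r * (\<integral>\<^sup>+s. ennreal (r powr (a / 2 - 1)) *
      ennreal (indicator {0<..} s * s powr (a / 2 - 1) * (1 - exp (- 1 / (4 * s)))) \<partial>lborel)"
    using assms
    by (intro arg_cong2[where f="(*)"] nn_integral_cong)
      (auto simp: indicator_def zero_less_mult_iff powr_mult mult_ac simp flip: ennreal_mult')
  also have "\<dots> = ennreal (r powr (a / 2)) * gauss_mixture a 1"
    unfolding gauss_mixture_def using assms
    by (subst nn_integral_cmult) (auto simp: powr_diff simp flip: mult.assoc ennreal_mult')
  finally show ?thesis .
qed

text \<open>Near 0 the integrand is at most s^(a/2 - 1), integrable since a > 0. Near infinity 1 -
  exp(-1/(4s)) \<le> 1/s gives the bound s^(a/2 - 2), integrable since a < 2.\<close>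

lemma gauss_mixture_finite:
  assumes "0 < a" "a < 2"
  shows "gauss_mixture a 1 < \<infinity>"
proof -
  let ?f = "\<lambda>s::real. s powr (a / 2 - 1)" and ?g = "\<lambda>s::real. s powr (a / 2 - 2)"
  have "(?f has_integral 1 powr (a / 2 - 1 + 1) / (a / 2 - 1 + 1)) {0..1}"
    using assms by (intro has_integral_powr_from_0) auto
  then have f: "(\<integral>\<^sup>+s. ennreal (indicator {0..1} s * ?f s) \<partial>lborel) < \<infinity>"
    by (subst nn_integral_has_integral_lebesgue) auto
  have "(?g has_integral - (1 powr (a / 2 - 2 + 1)) / (a / 2 - 2 + 1)) {1..}"
    using assms by (intro has_integral_powr_to_inf) auto
  then have g: "(\<integral>\<^sup>+s. ennreal (indicator {1..} s * ?g s) \<partial>lborel) < \<infinity>"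
    by (subst nn_integral_has_integral_lebesgue) auto
  have "(\<integral>\<^sup>+s. ennreal (indicator {0..1} s * ?f s + indicator {1..} s * ?g s) \<partial>lborel) < \<infinity>"
    using f g by (subst ennreal_plus) (auto simp: nn_integral_add)
  moreover have "gauss_mixture a 1 \<le> (\<integral>\<^sup>+s. ennreal (indicator {0..1} s * ?f s + indicator {1..} s * ?g s) \<partial>lborel)"
    unfolding gauss_mixture_def
  proof (intro nn_integral_mono ennreal_leI)
    fix s :: real
    show "indicator {0<..} s * s powr (a / 2 - 1) * (1 - exp (- 1 / (4 * s)))
        \<le> indicator {0..1} s * ?f s + indicator {1..} s * ?g s"
    proof (cases "0 < s")
      case True
      have "1 - exp (- 1 / (4 * s)) \<le> 1 / s"
        using exp_ge_add_one_self[of "- 1 / (4 * s)"] True by (simp add: field_simps)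
      then have "?f s * (1 - exp (- 1 / (4 * s))) \<le> ?f s * (1 / s)"
        by (intro mult_left_mono) auto
      also have "\<dots> = ?g s" using True powr_diff[of s "a/2-1" 1] by simp
      finally have 1: "?f s * (1 - exp (- 1 / (4 * s))) \<le> ?g s" .
      have "?f s * (1 - exp (- 1 / (4 * s))) \<le> ?f s * 1"
        by (intro mult_left_mono) auto
      moreover have "0 < s powr (a / 2 - 1)" "0 < s powr (a / 2 - 2)"
        using True by simp_all
      ultimately show ?thesis using 1 True
        unfolding indicator_def by (auto intro: add_increasing2 simp del: powr_one_eq_one)
    qed (auto simp: indicator_def)
  qed
  ultimately show ?thesis by (rule le_less_trans[rotated])
qed

text \<open>The integrand is strictly positive for s > 0, so a vanishing integral would make the
  interval (0,1] a null set.\<close>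

lemma gauss_mixture_pos: "gauss_mixture a 1 > 0"
proof -
  have "gauss_mixture a 1 \<noteq> 0"
  proof
    assume "gauss_mixture a 1 = 0"
    then have "AE s in lborel. ennreal (indicator {0<..} s * s powr (a / 2 - 1) * (1 - exp (- 1 / (4 * s)))) = 0"
      unfolding gauss_mixture_def by (subst (asm) nn_integral_0_iff_AE) auto
    then have "AE s in lborel. s \<notin> {0<..(1::real)}"
      by eventually_elim (auto simp: indicator_def ennreal_eq_0_iff mult_le_0_iff)
    then have "emeasure lborel {0<..(1::real)} = 0"
      by (subst (asm) AE_iff_measurable[where N="{0<..1}"]) auto
    then show False by simp
  qed
  then show ?thesis by (simp add: zero_less_iff_neq_zero)
qed

section \<open>Integrating 1 - cos against the weight\<close>

lemma c_const_pos: "0 < \<alpha> \<Longrightarrow> \<alpha> < 2 \<Longrightarrow> 0 < c_const p \<alpha>"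
  by (auto simp: c_const_def intro!: divide_pos_pos mult_pos_pos Gamma_real_pos)

lemma rho_nonneg: "0 < \<alpha> \<Longrightarrow> \<alpha> < 2 \<Longrightarrow> 0 \<le> rho \<alpha> t"
  by (simp add: rho_def c_const_pos less_imp_le)

lemma rho_measurable [measurable]: "rho \<alpha> \<in> borel_measurable borel"
  unfolding rho_def by measurable

text \<open>The weight is expanded into Gaussians and Tonelli moves the integral in t inside, where
  \<open>gaussian_one_minus_cos\<close> evaluates it. The remaining integral in s is
  \<open>gauss_mixture \<alpha>\<close> at |x|^2, whose scaling gives the power of |x|.\<close>

lemma nn_integral_one_minus_cos_rho:
  assumes "0 < \<alpha>" "\<alpha> < 2"
  obtains C where "C > 0"
    "\<And>x::'a::euclidean_space.
      (\<integral>\<^sup>+t. ennreal ((1 - cos (t \<bullet> x)) * rho \<alpha> t) \<partial>lborel) = ennreal (C * norm x powr \<alpha>)"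
proof
  let ?p = "real DIM('a)"
  let ?b = "\<alpha> + ?p"
  \<comment> \<open>The normalisation of \<open>rho\<close>, divided by the Gamma factor that the
    subordination formula produces for the exponent \<alpha> + p.\<close>
  define K where "K = inverse (c_const DIM('a) \<alpha>) / Gamma (?b / 2)"
  have b: "?b > 0" and K: "K > 0"
    using assms by (auto simp: K_def c_const_pos intro!: divide_pos_pos Gamma_real_pos add_pos_pos)
  define S where "S = enn2real (gauss_mixture \<alpha> 1)"
  have S: "gauss_mixture \<alpha> 1 = ennreal S" "S > 0"
    using gauss_mixture_finite[OF assms] gauss_mixture_pos[of \<alpha>] by (auto simp: S_def enn2real_positive_iff)
  show "K * pi powr (?p / 2) * S > 0"
    using K S by simp
  fix x :: 'a
  let ?k = "\<lambda>s t. ennreal (indicator {0<..} s * s powr (?b / 2 - 1) * exp (- s * (norm (t::'a))\<^sup>2))"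
  let ?h = "\<lambda>s. ennreal (indicator {0<..} s * s powr (?b / 2 - 1))"
  have "(\<integral>\<^sup>+t. ennreal ((1 - cos (t \<bullet> x)) * rho \<alpha> t) \<partial>lborel)
      = (\<integral>\<^sup>+t. ennreal (K * (1 - cos (t \<bullet> x))) * (\<integral>\<^sup>+s. ?k s t \<partial>lborel) \<partial>lborel)"
  proof (intro nn_integral_cong)
    fix t :: 'a
    show "ennreal ((1 - cos (t \<bullet> x)) * rho \<alpha> t)
        = ennreal (K * (1 - cos (t \<bullet> x))) * (\<integral>\<^sup>+s. ?k s t \<partial>lborel)"
    \<comment> \<open>The subordination formula excludes t = 0; there both sides vanish because 1 -
      cos 0 = 0.\<close>
    proof (cases "t = 0")
      case False
      have "(1 - cos (t \<bullet> x)) * rho \<alpha> t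
          = K * (1 - cos (t \<bullet> x)) * (Gamma (?b / 2) * norm t powr (- ?b))"
        using b Gamma_real_pos[of "?b / 2"] by (simp add: rho_def K_def less_imp_neq[symmetric])
      then show ?thesis
        using K by (simp only: norm_powr_subordination[OF b False]) (simp flip: ennreal_mult')
    qed simp
  qed
  also have "\<dots> = (\<integral>\<^sup>+t. \<integral>\<^sup>+s. ennreal (K * (1 - cos (t \<bullet> x))) * ?k s t \<partial>lborel \<partial>lborel)"
    by (intro nn_integral_cong nn_integral_cmult[symmetric]) measurable
  also have "\<dots> = (\<integral>\<^sup>+s. \<integral>\<^sup>+t. ennreal (K * (1 - cos (t \<bullet> x))) * ?k s t \<partial>lborel \<partial>lborel)"
    by (rule lborel_pair.Fubini') measurable
  also have "\<dots> = (\<integral>\<^sup>+s. (ennreal K * ?h s) *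
      (\<integral>\<^sup>+t. ennreal ((1 - cos (t \<bullet> x)) * exp (- s * (norm t)\<^sup>2)) \<partial>lborel) \<partial>lborel)"
    using K
    by (subst nn_integral_cmult[symmetric])
      (auto intro!: nn_integral_cong simp: mult_ac indicator_def simp flip: ennreal_mult')
  also have "\<dots> = (\<integral>\<^sup>+s. ennreal (K * pi powr (?p / 2)) *
      ennreal (indicator {0<..} s * s powr (\<alpha> / 2 - 1) * (1 - exp (- (norm x)\<^sup>2 / (4 * s)))) \<partial>lborel)"
  proof (intro nn_integral_cong)
    fix s :: real
    show "(ennreal K * ?h s) *
      (\<integral>\<^sup>+t. ennreal ((1 - cos (t \<bullet> x)) * exp (- s * (norm t)\<^sup>2)) \<partial>lborel)
      = ennreal (K * pi powr (?p / 2)) *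
      ennreal (indicator {0<..} s * s powr (\<alpha> / 2 - 1) * (1 - exp (- (norm x)\<^sup>2 / (4 * s))))"
    proof (cases "s > 0")
      case True
      \<comment> \<open>The factor s^(-p/2) of the Gaussian integral cancels the dimension in the
        exponent of s.\<close>
      have "s powr (?b / 2 - 1) * (pi / s) powr (?p / 2) = pi powr (?p / 2) * s powr (?b / 2 - 1 - ?p / 2)"
        using True by (simp add: powr_divide powr_diff)
      also have "?b / 2 - 1 - ?p / 2 = \<alpha> / 2 - 1"
        by (simp add: field_simps)
      finally have eq: "s powr (?b / 2 - 1) * (pi / s) powr (?p / 2) = pi powr (?p / 2) * s powr (\<alpha> / 2 - 1)" .
      with True K show ?thesis
        by (simp only: gaussian_one_minus_cos[OF True]) (simp add: mult.assoc flip: ennreal_mult')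
    qed auto
  qed
  also have "\<dots> = ennreal (K * pi powr (?p / 2)) * gauss_mixture \<alpha> ((norm x)\<^sup>2)"
    unfolding gauss_mixture_def by (rule nn_integral_cmult) measurable
  also have "gauss_mixture \<alpha> ((norm x)\<^sup>2) = ennreal (norm x powr \<alpha> * S)"
  \<comment> \<open>Scaling needs a positive argument; for x = 0 both sides are 0.\<close>
  proof (cases "x = 0")
    case False
    have "(norm x)\<^sup>2 powr (\<alpha> / 2) = norm x powr \<alpha>"
      using False by (simp add: powr_powr flip: powr_numeral)
    with False S show ?thesis
      by (subst gauss_mixture_scale) (auto simp: ennreal_mult')
  qed (simp add: gauss_mixture_def)
  also have "ennreal (K * pi powr (?p / 2)) * ennreal (norm x powr \<alpha> * S)
      = ennreal (K * pi powr (?p / 2) * (norm x powr \<alpha> * S))"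
    using K by (intro ennreal_mult'[symmetric]) auto
  finally show "(\<integral>\<^sup>+t. ennreal ((1 - cos (t \<bullet> x)) * rho \<alpha> t) \<partial>lborel)
      = ennreal (K * pi powr (?p / 2) * S * norm x powr \<alpha>)"
    by (simp only: mult_ac)
qed

section \<open>Characteristic functions and moments\<close>

text \<open>The pointwise identity at x = A(w) is averaged over w, and Tonelli exchanges the two
  integrals. The finite moment makes the result a genuine Bochner integral, so that such terms may
  later be added and subtracted.\<close>

lemma integral_one_minus_char_rho:
  fixes A :: "'v \<Rightarrow> 'a::euclidean_space"
  assumes \<alpha>: "0 < \<alpha>" "\<alpha> < 2" and "C > 0"
    and C: "\<And>x::'a. (\<integral>\<^sup>+t. ennreal ((1 - cos (t \<bullet> x)) * rho \<alpha> t) \<partial>lborel) = ennreal (C * norm x powr \<alpha>)"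
    and "prob_space N" and A[measurable]: "A \<in> borel_measurable N"
    and int: "integrable N (\<lambda>w. norm (A w) powr \<alpha>)"
  shows "has_bochner_integral lborel (\<lambda>t. (1 - Re (char_vec N A t)) * rho \<alpha> t)
           (C * (LINT w|N. norm (A w) powr \<alpha>))"
proof (rule has_bochner_integral_nn_integral)
  interpret N: prob_space N by fact
  interpret L: pair_sigma_finite N "lborel :: 'a measure" ..
  have int_iexp: "integrable N (\<lambda>w. iexp (t \<bullet> A w))" for t
    by (intro N.integrable_const_bound[of _ 1]) auto
  have int_cos: "integrable N (\<lambda>w. cos (t \<bullet> A w))" for t
    by (intro N.integrable_const_bound[of _ 1]) auto
  \<comment> \<open>This representation as an expectation yields both nonnegativity and
    measurability in t.\<close>
  have Re: "1 - Re (char_vec N A t) = (LINT w|N. 1 - cos (t \<bullet> A w))" for t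
    unfolding char_vec_def using int_cos
    by (subst integral_Re[OF int_iexp, symmetric], subst Bochner_Integration.integral_diff)
      (auto simp: Re_exp N.prob_space)
  have nonneg: "0 \<le> 1 - Re (char_vec N A t)" for t
    unfolding Re by (intro integral_nonneg_AE) auto
  show "(\<lambda>t. (1 - Re (char_vec N A t)) * rho \<alpha> t) \<in> borel_measurable lborel"
    unfolding Re by measurable
  show "AE t in lborel. 0 \<le> (1 - Re (char_vec N A t)) * rho \<alpha> t"
    by (intro AE_I2 mult_nonneg_nonneg nonneg rho_nonneg \<alpha>)
  show "0 \<le> C * (LINT w|N. norm (A w) powr \<alpha>)"
    using \<open>C > 0\<close> by (intro mult_nonneg_nonneg integral_nonneg_AE) auto
  have "(\<integral>\<^sup>+t. ennreal ((1 - Re (char_vec N A t)) * rho \<alpha> t) \<partial>lborel)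
      = (\<integral>\<^sup>+t. \<integral>\<^sup>+w. ennreal ((1 - cos (t \<bullet> A w)) * rho \<alpha> t) \<partial>N \<partial>lborel)"
  proof (intro nn_integral_cong)
    fix t
    show "ennreal ((1 - Re (char_vec N A t)) * rho \<alpha> t)
        = (\<integral>\<^sup>+w. ennreal ((1 - cos (t \<bullet> A w)) * rho \<alpha> t) \<partial>N)"
      unfolding Re using int_cos rho_nonneg[OF \<alpha>, of t] by (subst nn_integral_eq_integral) auto
  qed
  also have "\<dots> = (\<integral>\<^sup>+w. \<integral>\<^sup>+t. ennreal ((1 - cos (t \<bullet> A w)) * rho \<alpha> t) \<partial>lborel \<partial>N)"
    by (rule L.Fubini') measurable
  also have "\<dots> = ennreal (C * (LINT w|N. norm (A w) powr \<alpha>))"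
    unfolding C using \<open>C > 0\<close> int by (subst nn_integral_eq_integral) auto
  finally show "(\<integral>\<^sup>+t. ennreal ((1 - Re (char_vec N A t)) * rho \<alpha> t) \<partial>lborel)
      = ennreal (C * (LINT w|N. norm (A w) powr \<alpha>))" .
qed

text \<open>The bound |u + v| \<le> 2 max(|u|, |v|) treats exponents below and above 1
  alike.\<close>

lemma integrable_norm_powr_add:
  fixes U V :: "'v \<Rightarrow> 'a::euclidean_space"
  assumes "a > 0" and [measurable]: "U \<in> borel_measurable N" "V \<in> borel_measurable N"
    and int: "integrable N (\<lambda>w. norm (U w) powr a)" "integrable N (\<lambda>w. norm (V w) powr a)"
  shows "integrable N (\<lambda>w. norm (U w + V w) powr a)"
proof (rule Bochner_Integration.integrable_bound)
  show "integrable N (\<lambda>w. 2 powr a * (norm (U w) powr a + norm (V w) powr a))"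
    using int by auto
  have "norm (u + v) powr a \<le> 2 powr a * (norm u powr a + norm v powr a)" for u v :: 'a
  proof -
    have "norm (u + v) \<le> 2 * max (norm u) (norm v)"
      using norm_triangle_ineq[of u v] by linarith
    then have "norm (u + v) powr a \<le> (2 * max (norm u) (norm v)) powr a"
      using \<open>a > 0\<close> by (intro powr_mono2) auto
    also have "\<dots> = 2 powr a * max (norm u) (norm v) powr a"
      by (intro powr_mult)
    also have "\<dots> \<le> 2 powr a * (norm u powr a + norm v powr a)"
      by (intro mult_left_mono) (auto simp: max_def)
    finally show ?thesis .
  qed
  then show "AE w in N. norm (norm (U w + V w) powr a)
      \<le> norm (2 powr a * (norm (U w) powr a + norm (V w) powr a))"
    by auto
qed measurable

section \<open>Independent copies\<close>

text \<open>Measurability and integrability pass from (X, Y) to a copy because the laws agree. The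
  characteristic function of a linear combination factors over the index i by independence; within
  one pair the two components may be dependent, so each factor is a joint characteristic
  function.\<close>

lemma
  fixes X Y :: "'w \<Rightarrow> 'a::euclidean_space" and Xc Yc :: "nat \<Rightarrow> 'v \<Rightarrow> 'a"
  assumes iid: "iid_copies N I Xc Yc M X Y" and "prob_space N"
    and [measurable]: "X \<in> borel_measurable M" "Y \<in> borel_measurable M"
  shows iid_copies_measurable:
      "i \<in> I \<Longrightarrow> Xc i \<in> borel_measurable N" "i \<in> I \<Longrightarrow> Yc i \<in> borel_measurable N"
    and iid_copies_integrable:
      "\<And>f. i \<in> I \<Longrightarrow> f \<in> borel_measurable borel \<Longrightarrow> integrable M (\<lambda>w. f (X w, Y w)) \<Longrightarrow>
        integrable N (\<lambda>w. f (Xc i w, Yc i w) :: real)"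
    and char_vec_iid_copies:
      "finite I \<Longrightarrow> char_vec N (\<lambda>w. \<Sum>i\<in>I. a i *\<^sub>R Xc i w + b i *\<^sub>R Yc i w) t
        = (\<Prod>i\<in>I. joint_char M X Y (a i *\<^sub>R t) (b i *\<^sub>R t))"
proof -
  interpret N: prob_space N by fact
  let ?Z = "\<lambda>i w. (Xc i w, Yc i w)"
  have ind: "N.indep_vars (\<lambda>_. borel) ?Z I"
    and eq: "\<And>i. i \<in> I \<Longrightarrow> distr N borel (?Z i) = distr M borel (\<lambda>w. (X w, Y w))"
    using iid by (auto simp: iid_copies_def)
  have Z: "?Z i \<in> borel_measurable N" if "i \<in> I" for i
    using ind that by (auto simp: N.indep_vars_def)
  then show XY: "Xc i \<in> borel_measurable N" "Yc i \<in> borel_measurable N" if "i \<in> I" for i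
    using borel_measurable_continuous_on[OF continuous_on_fst[OF continuous_on_id] Z[OF that]]
      borel_measurable_continuous_on[OF continuous_on_snd[OF continuous_on_id] Z[OF that]] by simp_all
  have W: "(\<lambda>w. (X w, Y w)) \<in> borel_measurable M"
    by measurable
  show "integrable N (\<lambda>w. f (Xc i w, Yc i w))"
    if "i \<in> I" "f \<in> borel_measurable borel" "integrable M (\<lambda>w. f (X w, Y w))"
    for i and f :: "'a \<times> 'a \<Rightarrow> real"
    using that integrable_distr_eq[OF Z, of i f] integrable_distr_eq[OF W, of f] by (simp add: eq)
  let ?h = "\<lambda>i (x, y). iexp ((a i *\<^sub>R t) \<bullet> x + (b i *\<^sub>R t) \<bullet> y)"
  have h[measurable]: "?h i \<in> borel_measurable borel" for i
    unfolding case_prod_beta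
    by (intro borel_measurable_continuous_onI continuous_intros)
  show "char_vec N (\<lambda>w. \<Sum>i\<in>I. a i *\<^sub>R Xc i w + b i *\<^sub>R Yc i w) t
      = (\<Prod>i\<in>I. joint_char M X Y (a i *\<^sub>R t) (b i *\<^sub>R t))" if "finite I"
  proof -
    have ind': "N.indep_vars (\<lambda>_. borel) (\<lambda>i w. ?h i (?Z i w)) I"
      by (rule N.indep_vars_compose2[OF ind h])
    have "char_vec N (\<lambda>w. \<Sum>i\<in>I. a i *\<^sub>R Xc i w + b i *\<^sub>R Yc i w) t
        = (CLINT w|N. \<Prod>i\<in>I. ?h i (?Z i w))"
      unfolding char_vec_def using that
      by (simp add: inner_sum_right inner_add_right sum_distrib_left flip: exp_sum)
    also have "\<dots> = (\<Prod>i\<in>I. CLINT w|N. ?h i (?Z i w))"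
    proof (rule N.indep_vars_lebesgue_integral[OF that ind'])
      fix i assume "i \<in> I"
      from measurable_compose[OF Z[OF this] h[of i]]
      show "integrable N (\<lambda>w. ?h i (?Z i w))"
        by (intro N.integrable_const_bound[of _ 1]) auto
    qed
    also have "\<dots> = (\<Prod>i\<in>I. joint_char M X Y (a i *\<^sub>R t) (b i *\<^sub>R t))"
    proof (intro prod.cong refl)
      fix i assume "i \<in> I"
      from integral_distr[OF Z[OF this] h[of i]] integral_distr[OF W h[of i]] eq[OF this]
      show "(CLINT w|N. ?h i (?Z i w)) = joint_char M X Y (a i *\<^sub>R t) (b i *\<^sub>R t)"
        by (simp add: joint_char_def)
    qed
    finally show ?thesis .
  qed
qed

text \<open>Turns coefficients -1 of a copy into complex conjugation; setting one argument to 0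
  covers the marginals.\<close>

lemma joint_char_uminus: "joint_char M X Y (- s) (- t) = cnj (joint_char M X Y s t)"
proof -
  have "iexp (- s \<bullet> X w + - t \<bullet> Y w) = cnj (iexp (s \<bullet> X w + t \<bullet> Y w))" for w
    by (simp add: exp_cnj algebra_simps)
  then show ?thesis
    unfolding joint_char_def by (simp only: Bochner_Integration.integral_cnj)
qed

section \<open>The correlation as a ratio of moments\<close>

theorem theorem2p4:
  fixes M :: "'w measure" and N :: "'v measure"
    and X Y :: "'w \<Rightarrow> 'a::euclidean_space"
    and Xc Yc :: "nat \<Rightarrow> 'v \<Rightarrow> 'a"
    and \<alpha> :: real
  assumes "0 < \<alpha>" and "\<alpha> < 2"
    and "prob_space M" and "X \<in> borel_measurable M" and "Y \<in> borel_measurable M"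
    and "prob_space N" and "iid_copies N {1..4} Xc Yc M X Y"
    and "integrable M (\<lambda>w. norm (X w) powr \<alpha> + norm (Y w) powr \<alpha>)"
  shows
    "let J1 = (LINT w|N. norm (Xc 1 w + Yc 1 w - Xc 2 w - Yc 3 w) powr \<alpha>);
         J2 = (LINT w|N. norm (Xc 1 w + Yc 2 w - Xc 3 w - Yc 4 w) powr \<alpha>);
         J3 = (LINT w|N. norm (Xc 1 w + Yc 1 w - Xc 2 w - Yc 2 w) powr \<alpha>);
         K1 = (LINT w|N. norm (Xc 1 w - Xc 2 w) powr \<alpha>);
         K2 = (LINT w|N. norm (Yc 3 w - Yc 4 w) powr \<alpha>);
         K3 = (LINT w|N. norm (Xc 1 w - Xc 2 w + Yc 3 w - Yc 4 w) powr \<alpha>)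
     in siCor M \<alpha> X Y =
          (if K1 + K2 - K3 = 0 then 0 else (2 * J1 - J2 - J3) / (K1 + K2 - K3))"
proof -
  note [measurable] = assms(4,5)
  interpret M: prob_space M by fact
  obtain C where C: "C > 0" "\<And>x::'a.
      (\<integral>\<^sup>+t. ennreal ((1 - cos (t \<bullet> x)) * rho \<alpha> t) \<partial>lborel) = ennreal (C * norm x powr \<alpha>)"
    using nn_integral_one_minus_cos_rho[OF assms(1,2)] by blast
  have XYc[measurable]: "Xc i \<in> borel_measurable N" "Yc i \<in> borel_measurable N" if "i \<in> {1..4}" for i
    using iid_copies_measurable[OF assms(7,6,4,5) that] .
  \<comment> \<open>The moment hypothesis concerns a sum; it is transferred to the copy, and each
    nonnegative summand is then dominated by the sum.\<close>
  have lin: "integrable N (\<lambda>w. norm (a *\<^sub>R Xc i w + b *\<^sub>R Yc i w) powr \<alpha>)"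
    if i: "i \<in> {1..4}" for i a b
  proof -
    note [measurable] = XYc[OF i]
    have f: "(\<lambda>(x, y). norm x powr \<alpha> + norm y powr \<alpha>) \<in> borel_measurable (borel :: ('a \<times> 'a) measure)"
      unfolding case_prod_beta by (simp flip: borel_prod)
    have sum: "integrable N (\<lambda>w. norm (Xc i w) powr \<alpha> + norm (Yc i w) powr \<alpha>)"
      using iid_copies_integrable[OF assms(7,6,4,5) i f] assms(8) by simp
    have "integrable N (\<lambda>w. norm (Xc i w) powr \<alpha>)" "integrable N (\<lambda>w. norm (Yc i w) powr \<alpha>)"
      by (rule Bochner_Integration.integrable_bound[OF sum]; auto)+
    then show ?thesis
      using assms(1) by (intro integrable_norm_powr_add) (auto simp: powr_mult)
  qed
  define \<phi> where "\<phi> a b t = joint_char M X Y (a *\<^sub>R t) (b *\<^sub>R t)" for a b :: real and t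
  \<comment> \<open>All six expectations are instances of this one, with coefficients in {-1, 0, 1}.
    A pair with coefficients 0, 0 contributes the factor 1.\<close>
  have key: "has_bochner_integral lborel
      (\<lambda>t. (1 - Re (\<phi> a1 b1 t * \<phi> a2 b2 t * \<phi> a3 b3 t * \<phi> a4 b4 t)) * rho \<alpha> t)
      (C * (LINT w|N. norm (A w) powr \<alpha>))"
    if A: "\<And>w. A w = (a1 *\<^sub>R Xc 1 w + b1 *\<^sub>R Yc 1 w) + (a2 *\<^sub>R Xc 2 w + b2 *\<^sub>R Yc 2 w)
        + (a3 *\<^sub>R Xc 3 w + b3 *\<^sub>R Yc 3 w) + (a4 *\<^sub>R Xc 4 w + b4 *\<^sub>R Yc 4 w)"
    for A and a1 b1 a2 b2 a3 b3 a4 b4 :: real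
  proof -
    let ?c = "\<lambda>x1 x2 x3 x4 i. if i = 1 then x1 else if i = 2 then x2 else if i = 3 then x3 else (x4::real)"
    have I: "{1..4::nat} = {1, 2, 3, 4}" by auto
    have char: "char_vec N A t = \<phi> a1 b1 t * \<phi> a2 b2 t * \<phi> a3 b3 t * \<phi> a4 b4 t" for t
      using char_vec_iid_copies[OF assms(7,6,4,5), of "?c a1 a2 a3 a4" "?c b1 b2 b3 b4" t]
      unfolding I by (simp add: A[abs_def] \<phi>_def add.assoc mult.assoc)
    have [measurable]: "Xc i \<in> borel_measurable N" "Yc i \<in> borel_measurable N" if "i \<in> {1, 2, 3, 4}" for i
      using XYc[of i] that by auto
    have "integrable N (\<lambda>w. norm (A w) powr \<alpha>)"
      unfolding A using assms(1) by (intro integrable_norm_powr_add lin) auto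
    moreover have "A \<in> borel_measurable N"
      unfolding A[abs_def] by measurable
    ultimately show ?thesis
      using integral_one_minus_char_rho[OF assms(1,2) C assms(6), of A] unfolding char by simp
  qed
  define J1 J2 J3 K1 K2 K3 where
    "J1 = (LINT w|N. norm (Xc 1 w + Yc 1 w - Xc 2 w - Yc 3 w) powr \<alpha>)" and
    "J2 = (LINT w|N. norm (Xc 1 w + Yc 2 w - Xc 3 w - Yc 4 w) powr \<alpha>)" and
    "J3 = (LINT w|N. norm (Xc 1 w + Yc 1 w - Xc 2 w - Yc 2 w) powr \<alpha>)" and
    "K1 = (LINT w|N. norm (Xc 1 w - Xc 2 w) powr \<alpha>)" and
    "K2 = (LINT w|N. norm (Yc 3 w - Yc 4 w) powr \<alpha>)" and
    "K3 = (LINT w|N. norm (Xc 1 w - Xc 2 w + Yc 3 w - Yc 4 w) powr \<alpha>)"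
  note JK = this
  let ?f = "\<lambda>t. joint_char M X Y t t" and ?u = "char_vec M X" and ?v = "char_vec M Y"
  have \<phi>: "\<phi> 0 0 t = 1" "\<phi> 1 1 t = ?f t" "\<phi> (-1) (-1) t = cnj (?f t)"
    "\<phi> 1 0 t = ?u t" "\<phi> (-1) 0 t = cnj (?u t)" "\<phi> 0 1 t = ?v t" "\<phi> 0 (-1) t = cnj (?v t)" for t
    using joint_char_uminus[of M X Y t t] joint_char_uminus[of M X Y t 0] joint_char_uminus[of M X Y 0 t]
    by (simp_all add: \<phi>_def joint_char_def char_vec_def M.prob_space)
  \<comment> \<open>Only a shared index keeps X and Y together: \<open>Xc 1 + Yc 1\<close>
    contributes \<open>?f\<close>, while components with different indices contribute separate
    factors \<open>?u\<close>, \<open>?v\<close> or their conjugates.\<close>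
  have J: "has_bochner_integral lborel (\<lambda>t. (1 - Re (?f t * cnj (?u t) * cnj (?v t))) * rho \<alpha> t) (C * J1)"
    "has_bochner_integral lborel (\<lambda>t. (1 - Re (?u t * ?v t * cnj (?u t) * cnj (?v t))) * rho \<alpha> t) (C * J2)"
    "has_bochner_integral lborel (\<lambda>t. (1 - Re (?f t * cnj (?f t))) * rho \<alpha> t) (C * J3)"
    unfolding JK
    using
      key[of "\<lambda>w. Xc 1 w + Yc 1 w - Xc 2 w - Yc 3 w" 1 1 "-1" 0 0 "-1" 0 0]
      key[of "\<lambda>w. Xc 1 w + Yc 2 w - Xc 3 w - Yc 4 w" 1 0 0 1 "-1" 0 0 "-1"]
      key[of "\<lambda>w. Xc 1 w + Yc 1 w - Xc 2 w - Yc 2 w" 1 1 "-1" "-1" 0 0 0 0]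
    unfolding \<phi> by simp_all
  have K: "has_bochner_integral lborel (\<lambda>t. (1 - Re (?u t * cnj (?u t))) * rho \<alpha> t) (C * K1)"
    "has_bochner_integral lborel (\<lambda>t. (1 - Re (?v t * cnj (?v t))) * rho \<alpha> t) (C * K2)"
    "has_bochner_integral lborel (\<lambda>t. (1 - Re (?u t * cnj (?u t) * ?v t * cnj (?v t))) * rho \<alpha> t) (C * K3)"
    unfolding JK
    using
      key[of "\<lambda>w. Xc 1 w - Xc 2 w" 1 0 "-1" 0 0 0 0 0]
      key[of "\<lambda>w. Yc 3 w - Yc 4 w" 0 0 0 0 0 1 0 "-1"]
      key[of "\<lambda>w. Xc 1 w - Xc 2 w + Yc 3 w - Yc 4 w" 1 0 "-1" 0 0 1 0 "-1"]
    unfolding \<phi> by simp_all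
  \<comment> \<open>This is the expansion |f|^2 + |uv|^2 - 2 Re(f cnj(uv)). The constants 2 - 1 - 1
    cancel, so every term can be written with 1 - Re, which tames the singularity of the weight at 0
    and is integrable separately.\<close>
  have cov_eq: "(cmod (f - u * v))\<^sup>2 * r = 2 * ((1 - Re (f * cnj u * cnj v)) * r)
      - (1 - Re (u * v * cnj u * cnj v)) * r - (1 - Re (f * cnj f)) * r" for f u v r
  proof -
    have "(cmod (f - u * v))\<^sup>2 = 2 * (1 - Re (f * cnj u * cnj v))
        - (1 - Re (u * v * cnj u * cnj v)) - (1 - Re (f * cnj f))"
      unfolding cmod_power2 by (simp add: power2_eq_square algebra_simps)
    then show ?thesis by (simp only: left_diff_distrib mult.assoc)
  qed
  have "siCov M \<alpha> X Y = 2 * (C * J1) - C * J2 - C * J3"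
    unfolding siCov_def cov_eq
    by (intro has_bochner_integral_integral_eq has_bochner_integral_diff
        has_bochner_integral_mult_right J)
  then have cov: "siCov M \<alpha> X Y = C * (2 * J1 - J2 - J3)"
    by (simp add: algebra_simps)
  \<comment> \<open>With a = |u|^2 and b = |v|^2 this is (1 - a)(1 - b) = (1 - a) + (1 - b) - (1 -
    ab).\<close>
  have denom_eq: "(1 - (cmod u)\<^sup>2) * (1 - (cmod v)\<^sup>2) * r = (1 - Re (u * cnj u)) * r
      + (1 - Re (v * cnj v)) * r - (1 - Re (u * cnj u * v * cnj v)) * r" for u v r
  proof -
    have "(1 - (cmod u)\<^sup>2) * (1 - (cmod v)\<^sup>2) = (1 - Re (u * cnj u)) + (1 - Re (v * cnj v))
        - (1 - Re (u * cnj u * v * cnj v))"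
      unfolding cmod_power2 by (simp add: power2_eq_square algebra_simps)
    then show ?thesis by (simp only: left_diff_distrib distrib_right)
  qed
  have "siCor_denom M \<alpha> X Y = C * K1 + C * K2 - C * K3"
    unfolding siCor_denom_def denom_eq
    by (intro has_bochner_integral_integral_eq has_bochner_integral_diff has_bochner_integral_add K)
  then have denom: "siCor_denom M \<alpha> X Y = C * (K1 + K2 - K3)"
    by (simp add: algebra_simps)
  \<comment> \<open>The bound makes the denominator nonnegative. Hence the case distinction of
    \<open>siCor\<close> on a positive denominator agrees with the one on a nonzero denominator, as
    C > 0.\<close>
  have "cmod (char_vec M Z t) \<le> 1" if "Z \<in> borel_measurable M" for Z :: "'w \<Rightarrow> 'a" and t
  proof -
    have "cmod (char_vec M Z t) \<le> (LINT w|M. cmod (iexp (t \<bullet> Z w)))"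
      unfolding char_vec_def by (rule integral_norm_bound)
    then show ?thesis by (simp add: M.prob_space)
  qed
  then have "0 \<le> siCor_denom M \<alpha> X Y"
    unfolding siCor_denom_def
    by (intro integral_nonneg_AE AE_I2 mult_nonneg_nonneg rho_nonneg assms)
      (auto simp: power_le_one)
  then have "0 < siCor_denom M \<alpha> X Y \<longleftrightarrow> K1 + K2 - K3 \<noteq> 0"
    using denom C(1) by (auto simp: zero_le_mult_iff zero_less_mult_iff)
  then show ?thesis
    unfolding Let_def siCor_def JK[symmetric] using cov denom C(1) by auto
qed

end
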